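(* In the setting of the context, assume $q<q_c$ and let $\beta\in(0,1)$. For the estimate $\hat q$ (when $\hat q<q_c$), let $\bar q$ be the optimal value of the problem $$\max_{x\in[0,1]} x\quad\text{s.t.}\quad x\ge\hat q,\quad Q+(1-x)\hat K^\top R\hat K-(x-\hat q)A^\top\hat PB(R+B^\top\hat PB)^{-1}B^\top\hat PA\succ0 .$$ Then with probability at least $1-\beta$ (over the samples) the following holds: if $\hat q<q_c$ and $\bar q\ge\hat q+\Delta(N_q,\beta)$, where $\Delta(N_q,\beta)=\sqrt{\log(2/\beta)/(2N_q)}$, then $\hat K$ mean-square stabilizes the system.
   Context: Let $A\in\mathbb{R}^{n\times n}$, $B\in\mathbb{R}^{n\times m}$ with $(A,B)$ stabilizable, and let $Q$, $R$ be symmetric positive definite. Consider $x_{t+1}=Ax_t+\lambda_tBu_t$, $t\ge0$, with $x_0$ random with finite mean and covariance and $\{\lambda_t\}$ i.i.d. Bernoulli, independent of $x_0$, with $\mathcal{P}(\lambda_t=0)=q$, $q\in(0,1)$ unknown. The estimate is $\hat q=\frac1{N_q}\sum_{i=1}^{N_q}(1-\lambda_i)$ from $N_q$ i.i.d. samples with the same Bernoulli law. For $p\in[0,1)$ the modified Riccati equation with parameter $p$ is $X=Q+A^\top XA-(1-p)A^\top XB(R+B^\top XB)^{-1}B^\top XA$; $q_c$ is the critical loss probability such that for every $p\in[0,q_c)$ this equation has a unique positive definite solution. For $\hat q\in[0,q_c)$, $\hat P$ is the positive definite solution for parameter $\hat q$ and $\hat K=-(R+B^\top\hat PB)^{-1}B^\top\hat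 PA$. $\hat K$ mean-square stabilizes the system if the closed loop $x_{t+1}=(A+\lambda_tB\hat K)x_t$ satisfies $\lim_{t\to\infty}\mathbb{E}\{x_t^\top x_t\}=0$. *)

theory Defs
  imports "HOL-Analysis.Analysis" "HOL-Probability.Probability"
begin

text \<open>Matrices are HOL-Analysis vectors of vectors: real^'n^'n etc.
  Bernoulli variables lambda_t are booleans: True means lambda_t = 1 (packet delivered),
  False means lambda_t = 0 (loss), so P(lambda_t = 0) = q is bernoulli_pmf (1 - q).\<close>

definition posdef :: "real^'n^'n \<Rightarrow> bool" where
  "posdef X \<longleftrightarrow> transpose X = X \<and> (\<forall>x. x \<noteq> 0 \<longrightarrow> x \<bullet> (X *v x) > 0)"

text \<open>(A,B) stabilizable: some state feedback K makes x_{t+1} = (A + B K) x_t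
  asymptotically stable.\<close>
definition stabilizable :: "real^'n^'n \<Rightarrow> real^'m^'n \<Rightarrow> bool" where
  "stabilizable A B \<longleftrightarrow> (\<exists>K :: real^'n^'m. \<forall>x0.
      (\<lambda>t. (((*v) (A + B ** K)) ^^ t) x0) \<longlonglongrightarrow> 0)"

text \<open>Modified Riccati equation with parameter p.\<close>
definition MRE :: "real^'n^'n \<Rightarrow> real^'m^'n \<Rightarrow> real^'n^'n \<Rightarrow> real^'m^'m
      \<Rightarrow> real \<Rightarrow> real^'n^'n \<Rightarrow> bool" where
  "MRE A B Q R p X \<longleftrightarrow>
     X = Q + transpose A ** X ** A
         - (1 - p) *\<^sub>R (transpose A ** X ** B ** matrix_inv (R + transpose B ** X ** B)
                          ** transpose B ** X ** A)"

text \<open>Critical loss probability: the supremum of all c such that for every p in [0,c)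
  the modified Riccati equation has a unique positive definite solution.\<close>
definition crit_prob :: "real^'n^'n \<Rightarrow> real^'m^'n \<Rightarrow> real^'n^'n \<Rightarrow> real^'m^'m \<Rightarrow> real" where
  "crit_prob A B Q R = Sup {c \<in> {0..1}. \<forall>p \<in> {0..<c}. \<exists>!X. posdef X \<and> MRE A B Q R p X}"

text \<open>The positive definite solution for parameter p, and the associated gain.\<close>
definition ric_sol :: "real^'n^'n \<Rightarrow> real^'m^'n \<Rightarrow> real^'n^'n \<Rightarrow> real^'m^'m
      \<Rightarrow> real \<Rightarrow> real^'n^'n" where
  "ric_sol A B Q R p = (THE X. posdef X \<and> MRE A B Q R p X)"

definition ric_gain :: "real^'n^'n \<Rightarrow> real^'m^'n \<Rightarrow> real^'n^'n \<Rightarrow> real^'m^'m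
      \<Rightarrow> real \<Rightarrow> real^'n^'m" where
  "ric_gain A B Q R p =
     (let P = ric_sol A B Q R p in
        - (matrix_inv (R + transpose B ** P ** B) ** transpose B ** P ** A))"

text \<open>Optimal value of: max x in [0,1] s.t. x >= qh and the LMI is positive definite.\<close>
definition qbar :: "real^'n^'n \<Rightarrow> real^'m^'n \<Rightarrow> real^'n^'n \<Rightarrow> real^'m^'m
      \<Rightarrow> real \<Rightarrow> real" where
  "qbar A B Q R qh =
     (let P = ric_sol A B Q R qh; K = ric_gain A B Q R qh in
      Sup {x \<in> {0..1}. x \<ge> qh \<and>
        posdef (Q + (1 - x) *\<^sub>R (transpose K ** R ** K)
                 - (x - qh) *\<^sub>R (transpose A ** P ** B ** matrix_inv (R + transpose B ** P ** B)
                                   ** transpose B ** P ** A))})"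

text \<open>Closed-loop state x_{t+1} = (A + lambda_t B K) x_t.\<close>
primrec cl_state :: "real^'n^'n \<Rightarrow> real^'m^'n \<Rightarrow> real^'n^'m \<Rightarrow> real^'n
      \<Rightarrow> (nat \<Rightarrow> bool) \<Rightarrow> nat \<Rightarrow> real^'n" where
  "cl_state A B K x0 lam 0 = x0"
| "cl_state A B K x0 lam (Suc t) =
     (A + (if lam t then 1 else 0) *\<^sub>R (B ** K)) *v cl_state A B K x0 lam t"

text \<open>Law of the i.i.d. Bernoulli sequence (lambda_t), with P(lambda_t = 0) = q.\<close>
definition lam_measure :: "real \<Rightarrow> (nat \<Rightarrow> bool) measure" where
  "lam_measure q = PiM UNIV (\<lambda>_. measure_pmf (bernoulli_pmf (1 - q)))"

text \<open>K mean-square stabilizes the system: for every distribution mu of x_0 with finite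
  mean and covariance (finite second moment), x_0 independent of (lambda_t) (product measure),
  E[x_t^T x_t] tends to 0.\<close>
definition ms_stabilizes :: "real^'n^'n \<Rightarrow> real^'m^'n \<Rightarrow> real \<Rightarrow> real^'n^'m \<Rightarrow> bool" where
  "ms_stabilizes A B q K \<longleftrightarrow>
    (\<forall>\<mu> :: (real^'n) measure. prob_space \<mu> \<and> sets \<mu> = sets borel
        \<and> integrable \<mu> (\<lambda>x. norm x ^ 2) \<longrightarrow>
      (\<lambda>t. \<integral>\<^sup>+ \<omega>. ennreal ((cl_state A B K (fst \<omega>) (snd \<omega>) t) \<bullet> (cl_state A B K (fst \<omega>) (snd \<omega>) t))
              \<partial>(\<mu> \<Otimes>\<^sub>M lam_measure q)) \<longlonglongrightarrow> 0)"

text \<open>Estimate from N samples lambda_0..lambda_{N-1}.\<close>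
definition q_hat :: "nat \<Rightarrow> (nat \<Rightarrow> bool) \<Rightarrow> real" where
  "q_hat N s = (\<Sum>i<N. (if s i then 0 else 1)) / real N"

definition sample_pmf :: "nat \<Rightarrow> real \<Rightarrow> (nat \<Rightarrow> bool) pmf" where
  "sample_pmf N q = Pi_pmf {..<N} True (\<lambda>_. bernoulli_pmf (1 - q))"

definition Delta :: "nat \<Rightarrow> real \<Rightarrow> real" where
  "Delta N \<beta> = sqrt (ln (2 / \<beta>) / (2 * real N))"

end

theory Submission
  imports Defs
begin

text \<open>Hoeffding's inequality gives \<open>\<bar>q_hat - q\<bar> < \<Delta>\<close> with probability at least \<open>1 - \<beta>\<close>,
  and then \<open>q < q_hat + \<Delta> \<le> qbar\<close>. For the solution \<open>P\<close> of the modified Riccati equation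
  with parameter \<open>q_hat\<close> and its gain \<open>K\<close>, a completion of squares shows that under the
  true loss probability \<open>q\<close> the Lyapunov function \<open>V x = x\<^sup>T P x\<close> satisfies
  \<open>E[V(x(t+1)) | x(t) = x] = V x - x\<^sup>T L(q) x\<close>, where \<open>L(z)\<close> (\<open>qbar_lmi\<close>) is the matrix of the LMI defining
  \<open>qbar\<close>. Since \<open>L\<close> is antitone in \<open>z\<close> and positive definite at some \<open>z > q\<close>, \<open>L(q)\<close> is
  positive definite, so \<open>E V(x(t))\<close> and with it \<open>E |x(t)|\<^sup>2\<close> decay geometrically.\<close>

section \<open>Quadratic forms\<close>

abbreviation quad_form :: "real^'n^'n \<Rightarrow> real^'n \<Rightarrow> real" where
  "quad_form X x \<equiv> x \<bullet> (X *v x)"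

declare transpose_matrix_vector[simp del]

lemma inner_transpose_matrix_vector: "(a::real^'n) \<bullet> (transpose (C::real^'n^'m) *v b) = (C *v a) \<bullet> b"
  by (simp add: transpose_matrix_vector dot_lmul_matrix[symmetric] inner_commute)

lemma symmetric_matrix_inner_commute: "transpose (P::real^'n^'n) = P \<Longrightarrow> (P *v a) \<bullet> b = a \<bullet> (P *v b)"
  by (metis inner_transpose_matrix_vector inner_commute)

lemma matrix_vector_mult_uminus_left: "(- (X::real^'n^'m)) *v x = - (X *v x)"
  by (simp add: matrix_vector_mult_def vec_eq_iff sum_negf)

lemma transpose_add: "transpose ((X::real^'n^'m) + Y) = transpose X + transpose Y"
  by (simp add: transpose_def vec_eq_iff)

lemma quad_form_add: "quad_form (X + Y) x = quad_form X x + quad_form Y x"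
  by (simp add: matrix_vector_mult_add_rdistrib inner_add_right)

lemma quad_form_diff: "quad_form (X - Y) x = quad_form X x - quad_form Y x"
  by (simp add: matrix_vector_mult_diff_rdistrib inner_diff_right)

lemma quad_form_scaleR: "quad_form (a *\<^sub>R X) x = a * quad_form X x"
  by (simp flip: scaleR_matrix_vector_assoc)

lemma quad_form_congruence: "quad_form (transpose C ** X ** C) x = quad_form X (C *v x)"
  by (simp add: matrix_vector_mul_assoc[symmetric] inner_transpose_matrix_vector)

lemma quad_form_right_inverse:
  assumes "M ** Mi = mat 1"
  shows "quad_form Mi w = quad_form M (Mi *v w)"
proof -
  have "M *v (Mi *v w) = w" by (simp add: matrix_vector_mul_assoc assms)
  then show ?thesis by (metis inner_commute)
qed

lemma posdef_quad_form_nonneg: "posdef X \<Longrightarrow> 0 \<le> quad_form X x"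
  unfolding posdef_def by (cases "x = 0") (auto intro: less_imp_le)

lemma quad_form_lower_bound:
  fixes S :: "real^'n^'n"
  assumes pos: "\<And>x. x \<noteq> 0 \<Longrightarrow> 0 < quad_form S x"
  obtains e where "e > 0" "\<And>x. e * (norm x)\<^sup>2 \<le> quad_form S x"
proof -
  have cont: "continuous_on (sphere 0 1) (quad_form S)"
    by (intro continuous_intros linear_continuous_on matrix_vector_mul_linear)
  obtain a :: "real^'n" where "norm a = 1" using vector_choose_size[of 1] by auto
  then have "sphere (0::real^'n) 1 \<noteq> {}" by auto
  then obtain u where u: "u \<in> sphere 0 1" and umin: "\<And>y. y \<in> sphere 0 1 \<Longrightarrow> quad_form S u \<le> quad_form S y"
    using continuous_attains_inf[OF compact_sphere _ cont] by blast
  have "u \<noteq> 0" using u by auto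
  then have "0 < quad_form S u" by (rule pos)
  moreover have "quad_form S u * (norm x)\<^sup>2 \<le> quad_form S x" for x
  proof (cases "x = 0")
    case False
    define y where "y = (1 / norm x) *\<^sub>R x"
    have xy: "x = norm x *\<^sub>R y" using False by (simp add: y_def)
    have "quad_form S x = (norm x)\<^sup>2 * quad_form S y"
      by (subst (1 2) xy) (simp add: matrix_vector_mult_scaleR power2_eq_square)
    moreover have "quad_form S u \<le> quad_form S y" using umin False by (simp add: y_def del: inner_scaleR_left)
    ultimately show ?thesis by (simp add: mult.commute mult_right_mono)
  qed simp
  ultimately show thesis using that by blast
qed

lemma quad_form_upper_bound:
  fixes S :: "real^'n^'n"
  obtains C where "C > 0" "\<And>x. quad_form S x \<le> C * (norm x)\<^sup>2"
proof -
  obtain C where C: "C > 0" "\<And>x. norm (S *v x) \<le> norm x * C"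
    using bounded_linear.pos_bounded[OF matrix_vector_mul_bounded_linear] by blast
  have "quad_form S x \<le> C * (norm x)\<^sup>2" for x
  proof -
    have "quad_form S x \<le> norm x * norm (S *v x)" by (rule norm_cauchy_schwarz)
    also have "\<dots> \<le> norm x * (norm x * C)" using C by (simp add: mult_left_mono)
    finally show ?thesis by (simp add: power2_eq_square algebra_simps)
  qed
  with C show thesis using that by blast
qed

lemma quad_form_pos_right_invertible:
  assumes "\<And>x. x \<noteq> 0 \<Longrightarrow> 0 < quad_form M x"
  shows "M ** matrix_inv M = mat 1"
proof -
  have "\<forall>x. M *v x = 0 \<longrightarrow> x = 0" using assms by fastforce
  then have "invertible M"
    using matrix_left_invertible_ker invertible_left_inverse by blast
  then show ?thesis
    unfolding invertible_def matrix_inv_def by (rule someI_ex[THEN conjunct1])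
qed

lemma lyapunov_contraction:
  fixes P L :: "real^'n^'n"
  assumes "posdef P" and "\<And>x. x \<noteq> 0 \<Longrightarrow> 0 < quad_form L x"
  obtains c where "0 \<le> c" "c < 1" "\<And>x. quad_form P x - quad_form L x \<le> c * quad_form P x"
proof -
  obtain e where e: "e > 0" "\<And>x. e * (norm x)\<^sup>2 \<le> quad_form L x"
    using quad_form_lower_bound assms(2) by blast
  obtain C where C: "C > 0" "\<And>x. quad_form P x \<le> C * (norm x)\<^sup>2"
    using quad_form_upper_bound by blast
  define c where "c = 1 - e / (C + e)"
  \<comment> \<open>enlarging C to C + e keeps c nonnegative\<close>
  have "0 \<le> c" "c < 1" unfolding c_def using C e by (auto simp: field_simps)
  moreover have "quad_form P x - quad_form L x \<le> c * quad_form P x" for x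
  proof -
    have "quad_form P x \<le> (C + e) * (norm x)\<^sup>2"
      using C(2)[of x] e by (simp add: distrib_right add_increasing2)
    then have "(e / (C + e)) * quad_form P x \<le> (e / (C + e)) * ((C + e) * (norm x)\<^sup>2)"
      using C e by (intro mult_left_mono) auto
    also have "\<dots> = e * (norm x)\<^sup>2" using C e by simp
    finally show ?thesis using e(2)[of x] unfolding c_def by (simp add: algebra_simps)
  qed
  ultimately show thesis using that by blast
qed

section \<open>Mean-square stability from a Lyapunov function\<close>

lemma prob_space_lam_measure: "prob_space (lam_measure q)"
  unfolding lam_measure_def by (intro prob_space_PiM measure_pmf.prob_space_axioms)

lemma measurable_lam_measure_component:
  "(\<lambda>\<omega>. \<omega> i) \<in> measurable (lam_measure q) (count_space UNIV)"
proof -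
  have "(\<lambda>\<omega>. \<omega> i) \<in> measurable (lam_measure q) (measure_pmf (bernoulli_pmf (1 - q)))"
    unfolding lam_measure_def by (rule measurable_component_singleton) simp
  moreover have "measurable (lam_measure q) (measure_pmf (bernoulli_pmf (1 - q)))
      = measurable (lam_measure q) (count_space UNIV)"
    by (rule measurable_cong_sets) simp_all
  ultimately show ?thesis by simp
qed

lemma borel_measurable_cl_state:
  fixes A :: "real^'n^'n" and B :: "real^'m^'n" and K :: "real^'n^'m"
  assumes X0: "X0 \<in> borel_measurable M"
    and Lam: "\<And>i. (\<lambda>\<omega>. Lam \<omega> i) \<in> measurable M (count_space UNIV)"
  shows "(\<lambda>\<omega>. cl_state A B K (X0 \<omega>) (Lam \<omega>) t) \<in> borel_measurable M"
proof (induction t)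
  case 0 then show ?case using X0 by simp
next
  case (Suc t)
  have step: "(\<lambda>\<omega>. cl_state A B K (X0 \<omega>) (Lam \<omega>) (Suc t)) =
     (\<lambda>\<omega>. if Lam \<omega> t then (A + B ** K) *v cl_state A B K (X0 \<omega>) (Lam \<omega>) t
             else A *v cl_state A B K (X0 \<omega>) (Lam \<omega>) t)"
    by (simp add: fun_eq_iff)
  have "{\<omega> \<in> space M. Lam \<omega> t} \<in> sets M"
    using measurable_sets[OF Lam[of t], of "{True}"] by (simp add: vimage_def Int_def conj_commute)
  moreover have "(\<lambda>\<omega>. C *v cl_state A B K (X0 \<omega>) (Lam \<omega>) t) \<in> borel_measurable M"
    for C :: "real^'n^'n"
    by (rule borel_measurable_continuous_on[OF _ Suc])
      (intro linear_continuous_on matrix_vector_mul_bounded_linear)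
  ultimately show ?case unfolding step by (intro measurable_If)
qed

lemma borel_measurable_cl_state_pair:
  assumes "sets \<mu> = sets borel"
  shows "(\<lambda>\<omega>. cl_state A B K (fst \<omega>) (snd \<omega>) t) \<in> borel_measurable (\<mu> \<Otimes>\<^sub>M lam_measure q)"
proof (rule borel_measurable_cl_state)
  have "fst \<in> measurable (\<mu> \<Otimes>\<^sub>M lam_measure q) \<mu>" by (rule measurable_fst)
  moreover have "measurable (\<mu> \<Otimes>\<^sub>M lam_measure q) \<mu> = borel_measurable (\<mu> \<Otimes>\<^sub>M lam_measure q)"
    by (rule measurable_cong_sets) (simp_all add: assms)
  ultimately show "fst \<in> borel_measurable (\<mu> \<Otimes>\<^sub>M lam_measure q)" by simp
  show "(\<lambda>\<omega>. snd \<omega> i) \<in> measurable (\<mu> \<Otimes>\<^sub>M lam_measure q) (count_space UNIV)" for i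
    by (rule measurable_compose[OF measurable_snd measurable_lam_measure_component])
qed

lemma cl_state_Suc':
  "cl_state A B K x0 lam (Suc t) =
   cl_state A B K ((A + (if lam 0 then 1 else 0) *\<^sub>R (B ** K)) *v x0) (\<lambda>i. lam (Suc i)) t"
  by (induction t) simp_all

lemma (in prob_space) nn_integral_PiM_case_nat:
  assumes f[measurable]: "f \<in> borel_measurable (\<Pi>\<^sub>M i::nat\<in>UNIV. M)"
  shows "(\<integral>\<^sup>+\<omega>. f \<omega> \<partial>(\<Pi>\<^sub>M i\<in>UNIV. M)) = (\<integral>\<^sup>+b. (\<integral>\<^sup>+\<omega>. f (case_nat b \<omega>) \<partial>(\<Pi>\<^sub>M i\<in>UNIV. M)) \<partial>M)"
proof -
  interpret S: sequence_space M ..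
  have "(\<integral>\<^sup>+\<omega>. f \<omega> \<partial>S.S) = (\<integral>\<^sup>+X. f ((\<lambda>(s, \<omega>). case_nat s \<omega>) X) \<partial>(M \<Otimes>\<^sub>M S.S))"
    by (subst S.PiM_iter[symmetric]) (simp add: nn_integral_distr)
  also have "\<dots> = (\<integral>\<^sup>+x. \<integral>\<^sup>+X. f ((\<lambda>(s, \<omega>). case_nat s \<omega>) (x, X)) \<partial>S.S \<partial>M)"
    by (subst S.nn_integral_fst) simp_all
  finally show ?thesis by simp
qed

lemma continuous_on_quad_form: "continuous_on UNIV (quad_form P)"
  by (intro continuous_intros linear_continuous_on matrix_vector_mul_bounded_linear)

lemma nn_integral_quad_form_cl_state_le:
  fixes A :: "real^'n^'n" and B :: "real^'m^'n" and K :: "real^'n^'m" and P :: "real^'n^'n"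
  assumes q: "0 \<le> q" "q \<le> 1" and P: "posdef P" and c: "0 \<le> c"
    and dec: "\<And>x. (1 - q) * quad_form P ((A + B ** K) *v x) + q * quad_form P (A *v x)
                   \<le> c * quad_form P x"
  shows "(\<integral>\<^sup>+l. quad_form P (cl_state A B K x0 l t) \<partial>lam_measure q) \<le> c ^ t * quad_form P x0"
proof (induction t arbitrary: x0)
  case 0
  interpret prob_space "lam_measure q" by (rule prob_space_lam_measure)
  show ?case by (simp add: emeasure_space_1)
next
  case (Suc t)
  define L where "L = measure_pmf (bernoulli_pmf (1 - q))"
  interpret L: prob_space L unfolding L_def by (rule measure_pmf.prob_space_axioms)
  let ?x1 = "\<lambda>b. (A + (if b then 1 else 0) *\<^sub>R (B ** K)) *v x0"
  have "(\<lambda>l. cl_state A B K x0 l (Suc t)) \<in> borel_measurable (lam_measure q)"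
    by (rule borel_measurable_cl_state) (simp_all add: measurable_lam_measure_component)
  then have meas: "(\<lambda>l. ennreal (quad_form P (cl_state A B K x0 l (Suc t))))
      \<in> borel_measurable (\<Pi>\<^sub>M i::nat\<in>UNIV. L)"
    using borel_measurable_continuous_on[OF continuous_on_quad_form]
    unfolding lam_measure_def L_def by measurable
  have "(\<integral>\<^sup>+l. quad_form P (cl_state A B K x0 l (Suc t)) \<partial>lam_measure q)
      = (\<integral>\<^sup>+b. (\<integral>\<^sup>+l. quad_form P (cl_state A B K (?x1 b) l t) \<partial>lam_measure q) \<partial>L)"
    unfolding lam_measure_def L_def[symmetric]
    by (subst L.nn_integral_PiM_case_nat[OF meas]) (simp add: cl_state_Suc' del: cl_state.simps)
  also have "\<dots> \<le> (\<integral>\<^sup>+b. c ^ t * quad_form P (?x1 b) \<partial>L)"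
    by (rule nn_integral_mono) (rule Suc.IH)
  also have "\<dots> = ennreal (c ^ t * quad_form P ((A + B ** K) *v x0)) * (1 - q)
                 + ennreal (c ^ t * quad_form P (A *v x0)) * q"
    unfolding L_def using q by (subst nn_integral_bernoulli_pmf) simp_all
  also have "\<dots> = ennreal ((1 - q) * (c ^ t * quad_form P ((A + B ** K) *v x0))
                         + q * (c ^ t * quad_form P (A *v x0)))"
    using q c posdef_quad_form_nonneg[OF P] by (simp add: ennreal_mult[symmetric] mult.commute)
  also have "\<dots> \<le> c ^ Suc t * quad_form P x0"
    using mult_left_mono[OF dec[of x0], of "c ^ t"] c by (intro ennreal_leI) (simp add: algebra_simps)
  finally show ?case .
qed

lemma nn_integral_sq_norm_cl_state_le:
  fixes A :: "real^'n^'n" and B :: "real^'m^'n" and K :: "real^'n^'m" and P :: "real^'n^'n"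
    and \<mu> :: "(real^'n) measure"
  assumes q: "0 \<le> q" "q \<le> 1" and P: "posdef P" and c: "0 \<le> c"
    and dec: "\<And>x. (1 - q) * quad_form P ((A + B ** K) *v x) + q * quad_form P (A *v x)
                   \<le> c * quad_form P x"
    and \<mu>: "sets \<mu> = sets borel" "integrable \<mu> (\<lambda>x. (norm x)\<^sup>2)"
  obtains D where "\<And>t. (\<integral>\<^sup>+\<omega>. (cl_state A B K (fst \<omega>) (snd \<omega>) t) \<bullet> (cl_state A B K (fst \<omega>) (snd \<omega>) t)
                          \<partial>(\<mu> \<Otimes>\<^sub>M lam_measure q)) \<le> c ^ t * D"
proof -
  interpret L: prob_space "lam_measure q" by (rule prob_space_lam_measure)
  obtain m where m: "m > 0" "\<And>x. m * (norm x)\<^sup>2 \<le> quad_form P x"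
    using quad_form_lower_bound P unfolding posdef_def by blast
  obtain C where C: "C > 0" "\<And>x. quad_form P x \<le> C * (norm x)\<^sup>2"
    using quad_form_upper_bound by blast
  define I where "I = (\<integral>x. (norm x)\<^sup>2 \<partial>\<mu>)"
  have I: "(\<integral>\<^sup>+x. (norm x)\<^sup>2 \<partial>\<mu>) = I" "0 \<le> I"
    unfolding I_def by (simp_all add: nn_integral_eq_integral[OF \<mu>(2)])
  let ?x = "\<lambda>\<omega> t. cl_state A B K (fst \<omega>) (snd \<omega>) t"
  have V_meas: "(\<lambda>\<omega>. ennreal (quad_form P (?x \<omega> t))) \<in> borel_measurable (\<mu> \<Otimes>\<^sub>M lam_measure q)" for t
    by (intro measurable_compose[OF _ measurable_ennreal]
        borel_measurable_continuous_on[OF continuous_on_quad_form]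
        borel_measurable_cl_state_pair \<mu>(1))
  have "(\<integral>\<^sup>+\<omega>. ?x \<omega> t \<bullet> ?x \<omega> t \<partial>(\<mu> \<Otimes>\<^sub>M lam_measure q)) \<le> c ^ t * (C * I / m)" for t
  proof -
    have "(\<integral>\<^sup>+\<omega>. ?x \<omega> t \<bullet> ?x \<omega> t \<partial>(\<mu> \<Otimes>\<^sub>M lam_measure q))
       \<le> (\<integral>\<^sup>+\<omega>. ennreal (1 / m) * quad_form P (?x \<omega> t) \<partial>(\<mu> \<Otimes>\<^sub>M lam_measure q))"
    proof (rule nn_integral_mono)
      fix \<omega>
      have "?x \<omega> t \<bullet> ?x \<omega> t \<le> 1 / m * quad_form P (?x \<omega> t)"
        using m(2)[of "?x \<omega> t"] m(1) by (simp add: power2_norm_eq_inner field_simps)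
      then show "ennreal (?x \<omega> t \<bullet> ?x \<omega> t) \<le> ennreal (1 / m) * quad_form P (?x \<omega> t)"
        using m posdef_quad_form_nonneg[OF P] by (simp add: ennreal_mult[symmetric] ennreal_leI)
    qed
    also have "\<dots> = ennreal (1 / m) * (\<integral>\<^sup>+x0. (\<integral>\<^sup>+l. quad_form P (cl_state A B K x0 l t) \<partial>lam_measure q) \<partial>\<mu>)"
      using V_meas[of t] by (simp add: nn_integral_cmult L.nn_integral_fst[symmetric])
    also have "\<dots> \<le> ennreal (1 / m) * (\<integral>\<^sup>+x0. ennreal (c ^ t * C) * (norm x0)\<^sup>2 \<partial>\<mu>)"
    proof (intro mult_left_mono nn_integral_mono)
      fix x0 :: "real^'n"
      have "(\<integral>\<^sup>+l. quad_form P (cl_state A B K x0 l t) \<partial>lam_measure q) \<le> c ^ t * quad_form P x0"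
        by (rule nn_integral_quad_form_cl_state_le[OF q P c dec])
      also have "\<dots> \<le> ennreal (c ^ t * C) * (norm x0)\<^sup>2"
        using mult_left_mono[OF C(2)[of x0], of "c ^ t"] C c
        by (simp add: ennreal_mult[symmetric] ennreal_leI mult.assoc)
      finally show "(\<integral>\<^sup>+l. quad_form P (cl_state A B K x0 l t) \<partial>lam_measure q) \<le> ennreal (c ^ t * C) * (norm x0)\<^sup>2" .
    qed simp
    also have "\<dots> = ennreal (1 / m) * (ennreal (c ^ t * C) * I)"
      by (subst nn_integral_cmult) (simp_all add: I borel_measurable_integrable[OF \<mu>(2)])
    also have "\<dots> = ennreal (c ^ t * (C * I / m))"
      using m C c I by (simp add: ennreal_mult[symmetric] field_simps)
    finally show ?thesis .
  qed
  then show thesis using that by blast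
qed

lemma ms_stabilizes_if_contraction:
  fixes A :: "real^'n^'n" and B :: "real^'m^'n" and K :: "real^'n^'m" and P :: "real^'n^'n"
  assumes q: "0 \<le> q" "q \<le> 1" and P: "posdef P" and c: "0 \<le> c" "c < 1"
    and dec: "\<And>x. (1 - q) * quad_form P ((A + B ** K) *v x) + q * quad_form P (A *v x)
                   \<le> c * quad_form P x"
  shows "ms_stabilizes A B q K"
  unfolding ms_stabilizes_def
proof (intro allI impI, elim conjE)
  fix \<mu> :: "(real^'n) measure"
  assume "sets \<mu> = sets borel" and "integrable \<mu> (\<lambda>x. (norm x)\<^sup>2)"
  then obtain D where bound: "\<And>t. (\<integral>\<^sup>+\<omega>. (cl_state A B K (fst \<omega>) (snd \<omega>) t) \<bullet> (cl_state A B K (fst \<omega>) (snd \<omega>) t)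
                          \<partial>(\<mu> \<Otimes>\<^sub>M lam_measure q)) \<le> c ^ t * D"
    using nn_integral_sq_norm_cl_state_le[OF q P c(1) dec] by blast
  have "(\<lambda>t. c ^ t * D) \<longlonglongrightarrow> 0"
    using c by (intro tendsto_mult_left_zero LIMSEQ_power_zero) simp
  then have "(\<lambda>t. ennreal (c ^ t * D)) \<longlonglongrightarrow> ennreal 0"
    by (rule tendsto_ennrealI)
  then have lim: "(\<lambda>t. ennreal (c ^ t * D)) \<longlonglongrightarrow> 0"
    by simp
  show "(\<lambda>t. \<integral>\<^sup>+\<omega>. (cl_state A B K (fst \<omega>) (snd \<omega>) t) \<bullet> (cl_state A B K (fst \<omega>) (snd \<omega>) t)
                \<partial>(\<mu> \<Otimes>\<^sub>M lam_measure q)) \<longlonglongrightarrow> 0"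
    by (rule tendsto_sandwich[OF _ _ tendsto_const lim]) (simp_all add: bound)
qed

section \<open>The modified Riccati equation\<close>

lemma MRE_lyapunov_identity:
  fixes A Q P :: "real^'n^'n" and B :: "real^'m^'n" and R :: "real^'m^'m" and K :: "real^'n^'m"
  defines "M \<equiv> R + transpose B ** P ** B"
  defines "G \<equiv> transpose A ** P ** B ** matrix_inv M ** transpose B ** P ** A"
  assumes symP: "transpose P = P" and MRE: "MRE A B Q R p P" and inv: "M ** matrix_inv M = mat 1"
    and K: "K = - (matrix_inv M ** transpose B ** P ** A)"
  shows "(1 - q) * quad_form P ((A + B ** K) *v x) + q * quad_form P (A *v x)
       = quad_form P x - quad_form (Q + (1 - q) *\<^sub>R (transpose K ** R ** K) - (q - p) *\<^sub>R G) x"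
proof -
  define w where "w = transpose B *v (P *v (A *v x))"
  define v where "v = matrix_inv M *v w"
  have Kx: "K *v x = - v"
    unfolding K v_def w_def
    by (simp add: matrix_vector_mult_uminus_left matrix_vector_mul_assoc[symmetric])
  have "M *v v = w" unfolding v_def by (simp add: matrix_vector_mul_assoc inv)
  then have vw: "v \<bullet> w = quad_form R v + quad_form P (B *v v)"
    unfolding M_def by (metis quad_form_add quad_form_congruence)
  have cross: "(B *v v) \<bullet> (P *v (A *v x)) = v \<bullet> w"
    unfolding w_def by (simp add: inner_transpose_matrix_vector)
  then have cross': "(A *v x) \<bullet> (P *v (B *v v)) = v \<bullet> w"
    by (metis symmetric_matrix_inner_commute[OF symP] inner_commute)
  have Gx: "quad_form G x = v \<bullet> w"
    unfolding G_def v_def w_def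
    by (simp add: matrix_vector_mul_assoc[symmetric] inner_transpose_matrix_vector cross'
        flip: w_def v_def)
  have "(A + B ** K) *v x = A *v x - B *v v"
    by (simp add: matrix_vector_mult_add_rdistrib matrix_vector_mul_assoc[symmetric] Kx vec.neg)
  then have closed_loop:
    "quad_form P ((A + B ** K) *v x) = quad_form P (A *v x) - 2 * (v \<bullet> w) + quad_form P (B *v v)"
    using cross cross' by (simp add: matrix_vector_mult_diff_distrib inner_diff_left inner_diff_right)
  have "quad_form P x = quad_form Q x + quad_form P (A *v x) - (1 - p) * quad_form G x"
    using MRE unfolding MRE_def G_def M_def
    by (metis quad_form_add quad_form_diff quad_form_scaleR quad_form_congruence)
  then have riccati: "quad_form P x = quad_form Q x + quad_form P (A *v x) - (1 - p) * (v \<bullet> w)"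
    by (simp add: Gx)
  have lmi: "quad_form (Q + (1 - q) *\<^sub>R (transpose K ** R ** K) - (q - p) *\<^sub>R G) x
      = quad_form Q x + (1 - q) * quad_form R v - (q - p) * (v \<bullet> w)"
    by (simp add: quad_form_add quad_form_diff quad_form_scaleR quad_form_congruence Kx Gx
        vec.neg)
  show ?thesis
    unfolding closed_loop riccati lmi using vw by (simp add: algebra_simps)
qed

lemma ric_sol_posdef_MRE:
  assumes "0 \<le> p" and "p < crit_prob A B Q R"
  shows "posdef (ric_sol A B Q R p) \<and> MRE A B Q R p (ric_sol A B Q R p)"
proof -
  define S where "S = {c \<in> {0..1}. \<forall>p \<in> {0..<c}. \<exists>!X. posdef X \<and> MRE A B Q R p X}"
  have "0 \<in> S" and "bdd_above S" unfolding S_def by (auto intro: bdd_aboveI[of _ 1])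
  then obtain c where "c \<in> S" "p < c"
    using assms(2) less_cSup_iff[of S p] unfolding crit_prob_def S_def[symmetric] by blast
  then have "\<exists>!X. posdef X \<and> MRE A B Q R p X" using assms(1) unfolding S_def by auto
  then show ?thesis unfolding ric_sol_def by (rule theI')
qed

lemma riccati_matrix_right_invertible:
  fixes P :: "real^'n^'n" and B :: "real^'m^'n" and R :: "real^'m^'m"
  assumes "posdef R" and "posdef P"
  shows "(R + transpose B ** P ** B) ** matrix_inv (R + transpose B ** P ** B) = mat 1"
proof (rule quad_form_pos_right_invertible)
  fix z :: "real^'m" assume "z \<noteq> 0"
  then show "0 < quad_form (R + transpose B ** P ** B) z"
    using assms posdef_quad_form_nonneg[OF assms(2), of "B *v z"]
    unfolding quad_form_add quad_form_congruence posdef_def by (simp add: add_pos_nonneg)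
qed

lemma quad_form_riccati_term_nonneg:
  fixes A P :: "real^'n^'n" and B :: "real^'m^'n" and R :: "real^'m^'m"
  defines "M \<equiv> R + transpose B ** P ** B"
  assumes R: "posdef R" and P: "posdef P"
  shows "0 \<le> quad_form (transpose A ** P ** B ** matrix_inv M ** transpose B ** P ** A) x"
proof -
  have "transpose P = P" using P unfolding posdef_def by auto
  then have "transpose A ** P ** B ** matrix_inv M ** transpose B ** P ** A
      = transpose (transpose B ** P ** A) ** matrix_inv M ** (transpose B ** P ** A)"
    by (simp add: matrix_transpose_mul matrix_mul_assoc)
  then have "quad_form (transpose A ** P ** B ** matrix_inv M ** transpose B ** P ** A) x
      = quad_form M (matrix_inv M *v (transpose B ** P ** A *v x))"
    using quad_form_right_inverse[OF riccati_matrix_right_invertible[OF R P]]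
    by (simp add: quad_form_congruence M_def)
  also have "\<dots> \<ge> 0"
    unfolding M_def quad_form_add quad_form_congruence
    using posdef_quad_form_nonneg[OF R] posdef_quad_form_nonneg[OF P] by (simp add: add_nonneg_nonneg)
  finally show ?thesis .
qed

definition qbar_lmi :: "real^'n^'n \<Rightarrow> real^'m^'n \<Rightarrow> real^'n^'n \<Rightarrow> real^'m^'m
      \<Rightarrow> real \<Rightarrow> real \<Rightarrow> real^'n^'n" where
  "qbar_lmi A B Q R qh x =
     (let P = ric_sol A B Q R qh; K = ric_gain A B Q R qh in
      Q + (1 - x) *\<^sub>R (transpose K ** R ** K)
        - (x - qh) *\<^sub>R (transpose A ** P ** B ** matrix_inv (R + transpose B ** P ** B)
                          ** transpose B ** P ** A))"

lemma qbar_eq_Sup_qbar_lmi: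
  "qbar A B Q R qh = Sup {x \<in> {0..1}. x \<ge> qh \<and> posdef (qbar_lmi A B Q R qh x)}"
  unfolding qbar_def qbar_lmi_def Let_def ..

context
  fixes A Q :: "real^'n^'n" and B :: "real^'m^'n" and R :: "real^'m^'m" and qh :: real
  assumes Q: "posdef Q" and R: "posdef R" and qh: "0 \<le> qh" "qh < crit_prob A B Q R"
begin

lemma ric_gain_lyapunov_identity:
  "(1 - q) * quad_form (ric_sol A B Q R qh) ((A + B ** ric_gain A B Q R qh) *v x)
     + q * quad_form (ric_sol A B Q R qh) (A *v x)
   = quad_form (ric_sol A B Q R qh) x - quad_form (qbar_lmi A B Q R qh q) x"
proof -
  have P: "posdef (ric_sol A B Q R qh)" "MRE A B Q R qh (ric_sol A B Q R qh)"
    using ric_sol_posdef_MRE[OF qh] by auto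
  show ?thesis
    unfolding qbar_lmi_def Let_def
    by (rule MRE_lyapunov_identity[OF _ P(2) riccati_matrix_right_invertible[OF R P(1)]])
      (use P(1) in \<open>simp_all add: posdef_def ric_gain_def Let_def\<close>)
qed

lemma qbar_lmi_antimono:
  assumes "z \<le> z'"
  shows "quad_form (qbar_lmi A B Q R qh z') x \<le> quad_form (qbar_lmi A B Q R qh z) x"
proof -
  have "posdef (ric_sol A B Q R qh)" using ric_sol_posdef_MRE[OF qh] by auto
  then have "0 \<le> (z' - z) * quad_form (transpose A ** ric_sol A B Q R qh ** B
        ** matrix_inv (R + transpose B ** ric_sol A B Q R qh ** B)
        ** transpose B ** ric_sol A B Q R qh ** A) x"
    using assms by (simp add: quad_form_riccati_term_nonneg[OF R])
  moreover have "0 \<le> (z' - z) * quad_form (transpose (ric_gain A B Q R qh) ** R ** ric_gain A B Q R qh) x"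
    using assms posdef_quad_form_nonneg[OF R] by (simp add: quad_form_congruence)
  ultimately show ?thesis
    unfolding qbar_lmi_def Let_def quad_form_add quad_form_diff quad_form_scaleR
    by (simp add: algebra_simps)
qed

lemma qbar_lmi_posdef_at_estimate:
  assumes "qh \<le> 1"
  shows "posdef (qbar_lmi A B Q R qh qh)"
  unfolding posdef_def
proof
  have "transpose Q = Q" "transpose R = R" using Q R unfolding posdef_def by auto
  then show "transpose (qbar_lmi A B Q R qh qh) = qbar_lmi A B Q R qh qh"
    unfolding qbar_lmi_def Let_def
    by (simp add: transpose_add transpose_scalar matrix_transpose_mul matrix_mul_assoc)
  show "\<forall>x. x \<noteq> 0 \<longrightarrow> 0 < quad_form (qbar_lmi A B Q R qh qh) x"
    using Q posdef_quad_form_nonneg[OF R] assms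
    unfolding qbar_lmi_def Let_def posdef_def
    by (simp add: quad_form_add quad_form_scaleR quad_form_congruence add_pos_nonneg)
qed

lemma qbar_lmi_pos_of_less_qbar:
  assumes "qh \<le> 1" and "q < qbar A B Q R qh" and "x \<noteq> 0"
  shows "0 < quad_form (qbar_lmi A B Q R qh q) x"
proof -
  define F where "F = {x \<in> {0..1}. x \<ge> qh \<and> posdef (qbar_lmi A B Q R qh x)}"
  have "qh \<in> F" using qbar_lmi_posdef_at_estimate assms(1) qh(1) unfolding F_def by simp
  moreover have "bdd_above F" unfolding F_def by (auto intro: bdd_aboveI[of _ 1])
  ultimately obtain z where z: "z \<in> F" "q < z"
    using assms(2) less_cSup_iff[of F q] unfolding qbar_eq_Sup_qbar_lmi F_def[symmetric] by blast
  then have "0 < quad_form (qbar_lmi A B Q R qh z) x" using assms(3) unfolding F_def posdef_def by auto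
  also have "\<dots> \<le> quad_form (qbar_lmi A B Q R qh q) x" using z(2) by (intro qbar_lmi_antimono) simp
  finally show ?thesis .
qed

lemma ric_gain_ms_stabilizes:
  assumes "qh \<le> 1" and "0 \<le> q" "q \<le> 1" and "q < qbar A B Q R qh"
  shows "ms_stabilizes A B q (ric_gain A B Q R qh)"
proof -
  have P: "posdef (ric_sol A B Q R qh)" using ric_sol_posdef_MRE[OF qh] by auto
  obtain c where c: "0 \<le> c" "c < 1" and dec:
    "\<And>x. quad_form (ric_sol A B Q R qh) x - quad_form (qbar_lmi A B Q R qh q) x
          \<le> c * quad_form (ric_sol A B Q R qh) x"
    using lyapunov_contraction[OF P qbar_lmi_pos_of_less_qbar[OF assms(1,4)]] by blast
  show ?thesis
    by (rule ms_stabilizes_if_contraction[OF assms(2,3) P c])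
      (simp add: ric_gain_lyapunov_identity dec)
qed

end

section \<open>Estimation of the loss probability\<close>

lemma sample_pmf_component:
  "i < N \<Longrightarrow> map_pmf (\<lambda>s. s i) (sample_pmf N q) = bernoulli_pmf (1 - q)"
  unfolding sample_pmf_def by (simp add: Pi_pmf_component)

lemma q_hat_deviation_prob_le:
  fixes q \<beta> :: real and N :: nat
  assumes "0 < q" "q < 1" "0 < \<beta>" "\<beta> < 1" "N > 0"
  shows "measure_pmf.prob (sample_pmf N q) {s. \<bar>q_hat N s - q\<bar> \<ge> Delta N \<beta>} \<le> \<beta>"
proof -
  define loss where "loss = (\<lambda>b::bool. if b then 0 else 1 :: real)"
  have distr_loss: "distr (sample_pmf N q) borel (\<lambda>s. loss (s i))
      = distr (bernoulli_pmf (1 - q)) borel loss" if "i < N" for i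
    using sample_pmf_component[OF that, of q, symmetric]
    by (simp add: map_pmf_rep_eq distr_distr o_def)
  interpret Hoeffding_ineq_iid "sample_pmf N q" "{..<N}" "\<lambda>i s. loss (s i)" "\<lambda>s. loss (s 0)" 0 1 q
  proof unfold_locales
    show "prob_space.indep_vars (sample_pmf N q) (\<lambda>_. borel) (\<lambda>i s. loss (s i)) {..<N}"
      unfolding sample_pmf_def
      by (intro prob_space.indep_vars_compose2[OF _ indep_vars_Pi_pmf])
         (auto simp: measure_pmf.prob_space_axioms)
    have "measure_pmf.expectation (sample_pmf N q) (\<lambda>s. loss (s 0))
        = measure_pmf.expectation (map_pmf (\<lambda>s. s 0) (sample_pmf N q)) loss"
      by simp
    also have "\<dots> = q" using assms by (simp add: sample_pmf_component loss_def)
    finally show "q \<equiv> measure_pmf.expectation (sample_pmf N q) (\<lambda>s. loss (s 0))" by simp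
  qed (use assms distr_loss in \<open>auto simp: loss_def\<close>)
  have "0 \<le> Delta N \<beta>" unfolding Delta_def using assms by simp
  then have "measure_pmf.prob (sample_pmf N q)
      {s. \<bar>(\<Sum>i<N. loss (s i)) / real N - q\<bar> \<ge> Delta N \<beta>}
       \<le> 2 * exp (-2 * real N * (Delta N \<beta>)\<^sup>2)"
    using Hoeffding_ineq_abs_ge'[of "Delta N \<beta>"] \<open>N > 0\<close> by auto
  also have "\<dots> = \<beta>"
    using assms by (simp add: Delta_def exp_minus)
  finally show ?thesis unfolding q_hat_def loss_def .
qed

lemma q_hat_bounds:
  assumes "N > 0"
  shows "0 \<le> q_hat N s" "q_hat N s \<le> 1"
proof -
  have "(\<Sum>i<N. if s i then 0 else 1::real) \<le> (\<Sum>i<N. 1)" by (intro sum_mono) auto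
  then show "q_hat N s \<le> 1" unfolding q_hat_def using assms by simp
  show "0 \<le> q_hat N s" unfolding q_hat_def by (simp add: sum_nonneg)
qed

theorem theorem7:
  fixes A Q :: "real^'n^'n" and B :: "real^'m^'n" and R :: "real^'m^'m"
    and q \<beta> :: real and N :: nat
  assumes "stabilizable A B"
    and "posdef Q" and "posdef R"
    and "0 < q" and "q < 1"
    and "q < crit_prob A B Q R"
    and "0 < \<beta>" and "\<beta> < 1"
    and "N > 0"
  shows "measure_pmf.prob (sample_pmf N q)
           {s. q_hat N s < crit_prob A B Q R
               \<and> qbar A B Q R (q_hat N s) \<ge> q_hat N s + Delta N \<beta>
               \<longrightarrow> ms_stabilizes A B q (ric_gain A B Q R (q_hat N s))}
         \<ge> 1 - \<beta>"
proof -
  let ?good = "{s. q_hat N s < crit_prob A B Q R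
               \<and> qbar A B Q R (q_hat N s) \<ge> q_hat N s + Delta N \<beta>
               \<longrightarrow> ms_stabilizes A B q (ric_gain A B Q R (q_hat N s))}"
  have "ms_stabilizes A B q (ric_gain A B Q R (q_hat N s))"
    if "\<bar>q_hat N s - q\<bar> < Delta N \<beta>" and "q_hat N s < crit_prob A B Q R"
      and "qbar A B Q R (q_hat N s) \<ge> q_hat N s + Delta N \<beta>" for s
    using that assms(2-5) q_hat_bounds[OF \<open>N > 0\<close>, of s] by (intro ric_gain_ms_stabilizes) auto
  then have "{s. \<bar>q_hat N s - q\<bar> < Delta N \<beta>} \<subseteq> ?good" by auto
  then have "measure_pmf.prob (sample_pmf N q) {s. \<bar>q_hat N s - q\<bar> < Delta N \<beta>}
      \<le> measure_pmf.prob (sample_pmf N q) ?good"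
    by (rule measure_pmf.finite_measure_mono) simp
  moreover have "{s. \<bar>q_hat N s - q\<bar> < Delta N \<beta>} = UNIV - {s. \<bar>q_hat N s - q\<bar> \<ge> Delta N \<beta>}"
    by auto
  then have "measure_pmf.prob (sample_pmf N q) {s. \<bar>q_hat N s - q\<bar> < Delta N \<beta>}
      = 1 - measure_pmf.prob (sample_pmf N q) {s. \<bar>q_hat N s - q\<bar> \<ge> Delta N \<beta>}"
    using measure_pmf.prob_compl by simp
  ultimately show ?thesis
    using q_hat_deviation_prob_le[OF assms(4,5,7,8,9)] by linarith
qed

end
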